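(* Consider the SUM cost on an $s$–$t$ graph $G$ with $n\ge 1$ agents, $k\ge 1$ interceptors and parameter $\alpha>0$. Let $\varepsilon>0$. Then: 1. (Simple upper bound) $r(G,n,k,\alpha)\le\min(m_c,n)$. 2. (Upper bound) If $\alpha\ge\frac{m_c}{k\,\mathcal{E}_{m_c,n}\varepsilon}\left(n|p_{max}|-(1+\varepsilon)\mathcal{E}_{m_c,n}|p_{min}|\right)$, then $r(G,n,k,\alpha)\le(1+\varepsilon)\mathcal{E}_{m_c,n}$. 3. (Lower bound) If $\alpha\ge\frac{m_c}{k\,\mathcal{E}_{m_c,n}\varepsilon}\left((1-\varepsilon)\mathcal{E}_{m_c,n}\,n|p_{max}|-|p_{min}|\right)$, then $r(G,n,k,\alpha)\ge(1-\varepsilon)\mathcal{E}_{m_c,n}$. 4. (Limit) $\lim_{\alpha\to\infty}r(G,n,k,\alpha)=\mathcal{E}_{m_c,n}$.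
   Context: Graph: $G=(V,E,s,t)$ is a finite directed acyclic multigraph ($E$ is a multiset) with source $s$ and sink $t\neq s$, such that $E\ne\emptyset$ and every edge lies on some directed $s$–$t$ path. $P_{st}$ is the set of directed $s$–$t$ paths; a path is treated as a set of edges and $|p|$ is its number of edges. $p_{max},p_{min}$ are a longest and a shortest path in $P_{st}$. $m_c=m_c(G)$ is the minimum size of an $s$–$t$ cut of $G$. Strategies: each of the $n$ agents picks a path, giving $a=(a_1,\dots,a_n)\in(P_{st})^n$, with $\bigcup a=\bigcup_i a_i\subseteq E$; the $k$ interceptors pick $d=(d_1,\dots,d_k)\in E^k$. $\Delta X$ is the set of probability distributions on $X$. An element $\sigma=(\sigma_1,\dots,\sigma_n)\in(\Delta(P_{st}))^n$ is identified with the product distribution on $(P_{st})^n$ (uncorrelated agents); correlated agents use arbitrary $\sigma\in\Delta((P_{st})^n)$. SUM cost: $C(a,d,\alpha)=\left|\bigcup a\right|+\alpha\sum_{j\le k}\mathbf 1\{d_j\in\bigcup a\}$. For a distribution $\sigma$ on $(P_{st})^n$, $F_n(\sigma,\alpha)=\max_{d\in E^k}\mathbb{E}_{a\sim\sigma}[C(a,d,\alpha)]$. Price of uncorrelation: $$r(G,n,k,\alpha)=\frac{\min_{\sigma\in(\Delta(P_{st}))^n}F_n(\sigma,\alpha)}{\min_{\sigma\in\Delta((P_{st})^n)}F_n(\sigma,\alpha)}.$$ Notation: $\mathcal{E}_{\ell,n}=\ell\left(1-\left(1-\frac1\ell\right)^n\right)$. *)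

theory Defs
  imports "HOL-Probability.Product_PMF" "Graph_Theory.Arc_Walk"
begin

text \<open>
  Arcs are abstract objects with a tail and a head, so parallel arcs are allowed.
\<close>

locale st_graph = fin_digraph G for G :: "('v, 'e) pre_digraph" +
  fixes s t :: 'v
  assumes acyclic: "\<not> (\<exists>c. cycle c)"
    and source: "s \<in> verts G"
    and sink: "t \<in> verts G"
    and source_neq_sink: "s \<noteq> t"
    and arcs_nonempty: "arcs G \<noteq> {}"
    and arc_on_path: "\<And>e. e \<in> arcs G \<Longrightarrow> \<exists>p. apath s p t \<and> e \<in> set p"

text \<open>Paths are treated as sets of arcs.\<close>

definition st_paths :: "('v, 'e) pre_digraph \<Rightarrow> 'v \<Rightarrow> 'v \<Rightarrow> 'e set set" where
  "st_paths G s t = {set p | p. pre_digraph.apath G s p t}"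

definition max_path_size :: "('v, 'e) pre_digraph \<Rightarrow> 'v \<Rightarrow> 'v \<Rightarrow> nat" where
  "max_path_size G s t = Max (card ` st_paths G s t)"

definition min_path_size :: "('v, 'e) pre_digraph \<Rightarrow> 'v \<Rightarrow> 'v \<Rightarrow> nat" where
  "min_path_size G s t = Min (card ` st_paths G s t)"

definition st_cut :: "('v, 'e) pre_digraph \<Rightarrow> 'v \<Rightarrow> 'v \<Rightarrow> 'e set \<Rightarrow> bool" where
  "st_cut G s t S \<longleftrightarrow> S \<subseteq> arcs G \<and> (\<forall>p\<in>st_paths G s t. p \<inter> S \<noteq> {})"

definition min_cut_size :: "('v, 'e) pre_digraph \<Rightarrow> 'v \<Rightarrow> 'v \<Rightarrow> nat" where
  "min_cut_size G s t = Min (card ` {S. st_cut G s t S})"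

text \<open>
  The \<open>n\<close>-fold power of a set \<open>X\<close> is \<open>{..<n} \<rightarrow>\<^sub>E X\<close>: agents and
  interceptors are numbered from 0, and a tuple is \<open>undefined\<close> outside the index set.
\<close>

definition agent_profiles :: "('v, 'e) pre_digraph \<Rightarrow> 'v \<Rightarrow> 'v \<Rightarrow> nat \<Rightarrow> (nat \<Rightarrow> 'e set) set" where
  "agent_profiles G s t n = {..<n} \<rightarrow>\<^sub>E st_paths G s t"

definition interceptor_profiles :: "('v, 'e) pre_digraph \<Rightarrow> nat \<Rightarrow> (nat \<Rightarrow> 'e) set" where
  "interceptor_profiles G k = {..<k} \<rightarrow>\<^sub>E arcs G"

definition distributions_on :: "'a set \<Rightarrow> 'a pmf set" where
  "distributions_on X = {\<sigma>. set_pmf \<sigma> \<subseteq> X}"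

definition correlated :: "('v, 'e) pre_digraph \<Rightarrow> 'v \<Rightarrow> 'v \<Rightarrow> nat \<Rightarrow> (nat \<Rightarrow> 'e set) pmf set" where
  "correlated G s t n = distributions_on (agent_profiles G s t n)"

text \<open>The default value \<open>undefined\<close> matches the extensional tuples of \<open>agent_profiles\<close>.\<close>

definition uncorrelated :: "('v, 'e) pre_digraph \<Rightarrow> 'v \<Rightarrow> 'v \<Rightarrow> nat \<Rightarrow> (nat \<Rightarrow> 'e set) pmf set" where
  "uncorrelated G s t n =
     {Pi_pmf {..<n} undefined \<sigma> | \<sigma>. \<forall>i<n. \<sigma> i \<in> distributions_on (st_paths G s t)}"

lemma uncorrelated_subset_correlated: "uncorrelated G s t n \<subseteq> correlated G s t n"
proof
  fix \<tau> assume "\<tau> \<in> uncorrelated G s t n"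
  then obtain \<sigma> where \<tau>: "\<tau> = Pi_pmf {..<n} undefined \<sigma>"
    and \<sigma>: "\<forall>i<n. set_pmf (\<sigma> i) \<subseteq> st_paths G s t"
    by (auto simp: uncorrelated_def distributions_on_def)
  have "set_pmf \<tau> \<subseteq> PiE_dflt {..<n} undefined (\<lambda>i. set_pmf (\<sigma> i))"
    unfolding \<tau> using set_Pi_pmf_subset'[of "{..<n}" undefined \<sigma>] by (simp add: o_def)
  with \<sigma> show "\<tau> \<in> correlated G s t n"
    by (fastforce simp: correlated_def distributions_on_def agent_profiles_def
        PiE_dflt_def PiE_iff extensional_def split: if_splits)
qed

definition sum_cost :: "nat \<Rightarrow> nat \<Rightarrow> real \<Rightarrow> (nat \<Rightarrow> 'e set) \<Rightarrow> (nat \<Rightarrow> 'e) \<Rightarrow> real" where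
  "sum_cost n k \<alpha> a d =
     real (card (\<Union>i<n. a i)) + \<alpha> * (\<Sum>j<k. of_bool (d j \<in> (\<Union>i<n. a i)))"

definition worst_cost ::
    "('v, 'e) pre_digraph \<Rightarrow> nat \<Rightarrow> nat \<Rightarrow> real \<Rightarrow> (nat \<Rightarrow> 'e set) pmf \<Rightarrow> real" where
  "worst_cost G n k \<alpha> \<sigma> =
     Max ((\<lambda>d. measure_pmf.expectation \<sigma> (\<lambda>a. sum_cost n k \<alpha> a d)) ` interceptor_profiles G k)"

text \<open>
  A genuine minimum, not an infimum: the value is unspecified unless \<open>f\<close> attains
  its least value on \<open>X\<close>. (\<open>Min\<close> is unsuitable, as the image is infinite in general.)
\<close>

definition minimum_on :: "('a \<Rightarrow> real) \<Rightarrow> 'a set \<Rightarrow> real" where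
  "minimum_on f X = (LEAST y. y \<in> f ` X)"

definition price_of_uncorrelation ::
    "('v, 'e) pre_digraph \<Rightarrow> 'v \<Rightarrow> 'v \<Rightarrow> nat \<Rightarrow> nat \<Rightarrow> real \<Rightarrow> real" where
  "price_of_uncorrelation G s t n k \<alpha> =
     minimum_on (worst_cost G n k \<alpha>) (uncorrelated G s t n) /
     minimum_on (worst_cost G n k \<alpha>) (correlated G s t n)"

definition \<E> :: "nat \<Rightarrow> nat \<Rightarrow> real" where
  "\<E> l n = real l * (1 - (1 - 1 / real l) ^ n)"

end

theory Submission
  imports Defs "HOL-Real_Asymp.Real_Asymp"
begin

text \<open>
  Write \<open>q e\<close> for the probability that arc \<open>e\<close> is used by some agent. The interceptors do best by
  all sitting on a most used arc, so the worst cost is \<open>(\<Sum>e. q e) + \<alpha> * k * (MAX e. q e)\<close>, where the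
  first summand lies between \<open>pmin\<close> and \<open>n * pmax\<close>. On a minimum cut some arc has \<open>q e \<ge> 1 / m\<close>; for
  independent agents, AM-GM over the \<open>m\<close> cut arcs gives \<open>q e \<ge> 1 - (1 - 1 / m) ^ n = \<E> m n / m\<close> for
  some \<open>e\<close>. Both bounds on \<open>MAX e. q e\<close> are attained, by agents moving together or independently, given one random
  path that uses every arc with probability at most \<open>1 / m\<close>. Such a fractional form of Menger's theorem
  suffices and needs no disjoint paths: minimise \<open>\<Sum>e. (max 0 (q e - 1 / m))\<^sup>2\<close> over distributions on
  paths; if the minimum were positive, its gradient would be an arc weighting violating the
  inequality that the minimum cut size times the length of a shortest path is at most the total weight.

  For the bound by \<open>n\<close>, sample the agents independently from the marginals of an optimal correlated
  strategy; for the bound by \<open>m\<close>, send everybody along a shortest path.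
\<close>

subsection \<open>Minimisation over families of distributions\<close>

lemma continuous_on_Max:
  fixes f :: "'i \<Rightarrow> 'a::topological_space \<Rightarrow> real"
  assumes "finite I" "I \<noteq> {}" "\<And>i. i \<in> I \<Longrightarrow> continuous_on S (f i)"
  shows "continuous_on S (\<lambda>x. Max ((\<lambda>i. f i x) ` I))"
  using assms by (induction rule: finite_ne_induct) (auto intro: continuous_on_max)

lemma minimum_on_eq:
  assumes "x \<in> X" "\<And>y. y \<in> X \<Longrightarrow> f x \<le> f y"
  shows "minimum_on f X = f x"
  unfolding minimum_on_def using assms by (intro Least_equality) auto

text \<open>Compactness: over a finite \<open>X\<close> the families of mass functions form a closed
  subset of a product of compact sets. The index type \<open>'i\<close> lets one statement serve a
  single joint distribution (\<open>unit\<close>) and one distribution per agent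
  (\<open>nat\<close>).\<close>

lemma pmf_family_attains_min:
  fixes \<Phi> :: "('i \<times> 'a \<Rightarrow> real) \<Rightarrow> real"
  assumes fin: "finite X" and ne: "X \<noteq> {}" and cont: "continuous_on UNIV \<Phi>"
  obtains \<sigma> :: "'i \<Rightarrow> 'a pmf" where "\<And>i. set_pmf (\<sigma> i) \<subseteq> X"
    "\<And>\<tau>. (\<And>i. set_pmf (\<tau> i) \<subseteq> X) \<Longrightarrow>
       \<Phi> (\<lambda>(i, x). pmf (\<sigma> i) x) \<le> \<Phi> (\<lambda>(i, x). pmf (\<tau> i) x)"
proof -
  \<comment> \<open>The box forces mass 0 outside \<open>X\<close>, so that the finite sum in
    \<open>T\<close> is the total mass.\<close>
  define B :: "'i \<times> 'a \<Rightarrow> real set" where "B = (\<lambda>(i, x). if x \<in> X then {0..1} else {0})"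
  define T where "T = {f :: 'i \<times> 'a \<Rightarrow> real. \<forall>i. (\<Sum>x\<in>X. f (i, x)) = 1}"
  define K where "K = PiE UNIV B \<inter> T"
  \<comment> \<open>Tychonoff's theorem: \<open>'i\<close> may be infinite, so compactness is taken
    in the product topology.\<close>
  have "compactin (product_topology (\<lambda>_. euclidean) UNIV) (PiE UNIV B)"
    by (subst compactin_PiE) (auto simp: B_def)
  then have "compact (PiE UNIV B)"
    by (simp add: euclidean_product_topology)
  moreover have "closed T"
    unfolding T_def by (intro closed_Collect_all closed_Collect_eq continuous_intros) simp
  ultimately have "compact K"
    unfolding K_def by (rule compact_Int_closed)
  have pmf_in_K: "(\<lambda>(i, x). pmf (\<tau> i) x) \<in> K" if "\<And>i. set_pmf (\<tau> i) \<subseteq> X" for \<tau> :: "'i \<Rightarrow> 'a pmf"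
    using that fin by (auto simp: K_def T_def B_def pmf_le_1 sum_pmf_eq_1 PiE_iff set_pmf_eq)
  \<comment> \<open>The converse inclusion turns the minimiser found in \<open>K\<close> back into
    distributions.\<close>
  have K_pmf: "\<exists>\<tau>. (\<forall>i. set_pmf (\<tau> i) \<subseteq> X) \<and> f = (\<lambda>(i, x). pmf (\<tau> i) x)" if f: "f \<in> K" for f
  proof -
    have B: "f (i, x) \<in> B (i, x)" for i x
      using f by (auto simp: K_def PiE_iff)
    have nonneg: "f (i, x) \<ge> 0" for i x
      using B[of i x] by (auto simp: B_def split: if_splits)
    have zero: "f (i, x) = 0" if "x \<notin> X" for i x
      using B[of i x] that by (auto simp: B_def)
    define \<tau> where "\<tau> i = embed_pmf (\<lambda>x. f (i, x))" for i
    have "(\<integral>\<^sup>+x. ennreal (f (i, x)) \<partial>count_space UNIV) = 1" for i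
    proof -
      have "(\<integral>\<^sup>+x. ennreal (f (i, x)) \<partial>count_space UNIV) = (\<Sum>x\<in>X. ennreal (f (i, x)))"
        by (intro nn_integral_count_space'[OF fin]) (auto simp: zero)
      also have "\<dots> = ennreal (\<Sum>x\<in>X. f (i, x))"
        by (intro sum_ennreal) (auto simp: nonneg)
      also have "\<dots> = 1"
        using f by (simp add: K_def T_def)
      finally show ?thesis .
    qed
    then have "pmf (\<tau> i) x = f (i, x)" for i x
      unfolding \<tau>_def using nonneg by (subst pmf_embed_pmf) auto
    then show ?thesis
      using zero by (intro exI[of _ \<tau>]) (fastforce simp: set_pmf_eq)
  qed
  have "K \<noteq> {}"
    using pmf_in_K[of "\<lambda>_. return_pmf (SOME x. x \<in> X)"] ne by (auto simp: some_in_eq)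
  then obtain f where f: "f \<in> K" "\<And>g. g \<in> K \<Longrightarrow> \<Phi> f \<le> \<Phi> g"
    using continuous_attains_inf[OF \<open>compact K\<close>] continuous_on_subset[OF cont] by blast
  obtain \<sigma> where "\<forall>i. set_pmf (\<sigma> i) \<subseteq> X" "f = (\<lambda>(i, x). pmf (\<sigma> i) x)"
    using K_pmf[OF f(1)] by blast
  with f(2) pmf_in_K show ?thesis
    by (intro that[of \<sigma>]) blast+
qed

subsection \<open>Hitting probabilities\<close>

definition hit :: "nat \<Rightarrow> (nat \<Rightarrow> 'e set) pmf \<Rightarrow> 'e \<Rightarrow> real" where
  "hit n \<sigma> e = measure_pmf.prob \<sigma> {a. e \<in> (\<Union>i<n. a i)}"

lemma hit_le_1: "hit n \<sigma> e \<le> 1"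
  by (simp add: hit_def)

text \<open>That all agents miss \<open>e\<close> is a product event, so independence factorises its
  probability.\<close>

lemma hit_Pi_pmf:
  "hit n (Pi_pmf {..<n} dflt \<sigma>) e = 1 - (\<Prod>i<n. 1 - measure_pmf.prob (\<sigma> i) {p. e \<in> p})"
proof -
  have "hit n (Pi_pmf {..<n} dflt \<sigma>) e =
      1 - measure_pmf.prob (Pi_pmf {..<n} dflt \<sigma>) (- {a. e \<in> (\<Union>i<n. a i)})"
    unfolding hit_def by (subst measure_pmf.prob_compl[symmetric]) (auto simp: Compl_eq_Diff_UNIV double_diff)
  also have "- {a. e \<in> (\<Union>i<n. a i)} = Pi {..<n} (\<lambda>_. - {p. e \<in> p})"
    by auto
  also have "measure_pmf.prob (Pi_pmf {..<n} dflt \<sigma>) \<dots> =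
      (\<Prod>i<n. measure_pmf.prob (\<sigma> i) (- {p. e \<in> p}))"
    by (rule measure_Pi_pmf_Pi) simp
  also have "\<dots> = (\<Prod>i<n. 1 - measure_pmf.prob (\<sigma> i) {p. e \<in> p})"
    by (intro prod.cong refl) (simp add: measure_pmf.prob_compl[symmetric] Compl_eq_Diff_UNIV)
  finally show ?thesis .
qed

lemma hit_le_sum: "hit n \<sigma> e \<le> (\<Sum>i<n. measure_pmf.prob \<sigma> {a. e \<in> a i})"
proof -
  have "{a. e \<in> (\<Union>i<n. a i)} = (\<Union>i<n. {a. e \<in> a i})"
    by auto
  then show ?thesis
    unfolding hit_def by (simp only:) (intro measure_pmf.finite_measure_subadditive_finite, auto)
qed

lemma hit_ge:
  assumes "i < n"
  shows "measure_pmf.prob \<sigma> {a. e \<in> a i} \<le> hit n \<sigma> e"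
  unfolding hit_def using assms by (intro measure_pmf.finite_measure_mono) auto

subsection \<open>Real inequalities and limits\<close>

text \<open>AM-GM with the root removed. It serves for the probabilities that one agent misses the
  arcs of a cut, where only an upper bound \<open>c\<close> on their sum is known.\<close>

lemma prod_le_mean_power:
  fixes x :: "'a \<Rightarrow> real"
  assumes "finite S" "S \<noteq> {}" "\<And>i. i \<in> S \<Longrightarrow> x i \<ge> 0" "(\<Sum>i\<in>S. x i) \<le> c"
  shows "(\<Prod>i\<in>S. x i) \<le> (c / real (card S)) ^ card S"
proof -
  let ?m = "card S"
  have m: "?m > 0"
    using assms by (simp add: card_gt_0_iff)
  have P: "(\<Prod>i\<in>S. x i) \<ge> 0"
    using assms(3) by (rule prod_nonneg)
  have "(\<Prod>i\<in>S. x i) powr (1 / ?m) \<le> (\<Sum>i\<in>S. x i / ?m)"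
    using assms by (intro arith_geom_mean) auto
  also have "\<dots> \<le> c / ?m"
    using assms(4) by (simp add: sum_divide_distrib[symmetric] divide_right_mono)
  finally have "((\<Prod>i\<in>S. x i) powr (1 / ?m)) ^ ?m \<le> (c / ?m) ^ ?m"
    by (intro power_mono) auto
  \<comment> \<open>A zero product is treated apart because \<open>powr_realpow\<close> requires a
    positive base.\<close>
  moreover have "((\<Prod>i\<in>S. x i) powr (1 / ?m)) ^ ?m = (\<Prod>i\<in>S. x i)"
    using m P by (cases "(\<Prod>i\<in>S. x i) = 0") (auto simp: powr_realpow[symmetric] powr_powr)
  ultimately show ?thesis
    by simp
qed

text \<open>First-order condition at an endpoint: divide by \<open>x\<close> and let
  \<open>x\<close> tend to 0. One explicit small \<open>x\<close> replaces the limit.\<close>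

lemma nonneg_if_quadratic_nonneg:
  fixes S N :: real
  assumes "N \<ge> 0" and ge: "\<And>x. 0 < x \<Longrightarrow> x < 1 \<Longrightarrow> 0 \<le> 2 * x * S + x\<^sup>2 * N"
  shows "0 \<le> S"
proof (rule ccontr)
  assume "\<not> 0 \<le> S"
  \<comment> \<open>For \<open>S < 0\<close> the denominator exceeds both \<open>- S\<close> and
    \<open>N\<close>, hence \<open>x < 1\<close> and \<open>x * N \<le> - S\<close>, which leaves
    \<open>2 * S + x * N \<le> S < 0\<close>.\<close>
  define x where "x = - S / (N - S + 1)"
  have x: "0 < x" "x < 1"
    using \<open>\<not> 0 \<le> S\<close> \<open>N \<ge> 0\<close> by (auto simp: x_def field_simps)
  have "x * N \<le> - S"
    using \<open>\<not> 0 \<le> S\<close> \<open>N \<ge> 0\<close> by (auto simp: x_def field_simps mult_nonneg_nonpos2)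
  then have "2 * S + x * N < 0"
    using \<open>\<not> 0 \<le> S\<close> by linarith
  then have "x * (2 * S + x * N) < 0"
    using x by (simp add: mult_pos_neg)
  with ge[OF x] show False
    by (simp add: algebra_simps power2_eq_square)
qed

text \<open>Second-order expansion of the squared positive part, whose derivative is
  \<open>2 * max 0 x\<close>. It holds because \<open>max 0 (x + h)\<close> is at most the absolute
  value of \<open>max 0 x + h\<close>.\<close>

lemma max_0_add_square_le:
  fixes x h :: real
  shows "(max 0 (x + h))\<^sup>2 \<le> (max 0 x)\<^sup>2 + 2 * h * max 0 x + h\<^sup>2"
proof -
  have "(max 0 (x + h))\<^sup>2 \<le> (max 0 x + h)\<^sup>2"
    by (rule abs_le_square_iff[THEN iffD1]) auto
  then show ?thesis
    by (simp add: power2_sum algebra_simps)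
qed

lemma \<E>_div: "m > 0 \<Longrightarrow> \<E> m n / real m = 1 - (1 - 1 / real m) ^ n"
  by (simp add: \<E>_def)

lemma \<E>_pos:
  assumes "m > 0" "n > 0"
  shows "\<E> m n > 0"
proof -
  have "(1 - 1 / real m) ^ n < 1"
    using assms power_strict_mono[of "1 - 1 / real m" 1 n] by simp
  then show ?thesis
    using assms by (simp add: \<E>_def)
qed

text \<open>The quotient equals \<open>E + (a - b * E) / (b + x * c)\<close> once the denominator is
  positive, and there the numerator is constant.\<close>

lemma tendsto_affine_ratio:
  fixes a b c E :: real
  assumes "c > 0"
  shows "((\<lambda>x. (a + x * c * E) / (b + x * c)) \<longlongrightarrow> E) at_top"
proof -
  have "filterlim (\<lambda>x. b + x * c) at_top at_top"
    using assms by real_asymp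
  then have "((\<lambda>x. (a - b * E) / (b + x * c)) \<longlongrightarrow> 0) at_top"
    by (intro tendsto_divide_0[OF tendsto_const] filterlim_at_top_imp_at_infinity)
  then have "((\<lambda>x. E + (a - b * E) / (b + x * c)) \<longlongrightarrow> E + 0) at_top"
    by (intro tendsto_intros)
  moreover have "eventually (\<lambda>x. E + (a - b * E) / (b + x * c) = (a + x * c * E) / (b + x * c)) at_top"
  proof -
    have "eventually (\<lambda>x. b + x * c > 0) at_top"
      using assms by real_asymp
    then show ?thesis
      by eventually_elim (simp add: field_simps)
  qed
  ultimately show ?thesis
    by (simp add: filterlim_cong)
qed

subsection \<open>Worst-case cost\<close>

context st_graph
begin

abbreviation "paths \<equiv> st_paths G s t"

lemma finite_st_paths: "finite paths"
  using finite_imageI[OF apaths_finite[of s t], of set] by (simp add: st_paths_def setcompr_eq_image)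

lemma st_paths_nonempty: "paths \<noteq> {}"
  using arcs_nonempty arc_on_path unfolding st_paths_def by blast

lemma st_path_subset: "p \<in> paths \<Longrightarrow> p \<subseteq> arcs G"
  by (auto simp: st_paths_def apath_def)

lemma finite_st_path: "p \<in> paths \<Longrightarrow> finite p"
  by (rule finite_subset[OF st_path_subset finite_arcs])

lemma st_path_nonempty: "p \<in> paths \<Longrightarrow> p \<noteq> {}"
  using source_neq_sink by (auto simp: st_paths_def apath_def awalk_Nil_iff)

lemma finite_agent_profiles: "finite (agent_profiles G s t n)"
  unfolding agent_profiles_def by (intro finite_PiE finite_st_paths) auto

lemma agent_profiles_nonempty: "agent_profiles G s t n \<noteq> {}"
  using st_paths_nonempty by (auto simp: agent_profiles_def PiE_eq_empty_iff)

lemma finite_interceptor_profiles: "finite (interceptor_profiles G k)"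
  unfolding interceptor_profiles_def by (intro finite_PiE) auto

lemma interceptor_profiles_nonempty: "interceptor_profiles G k \<noteq> {}"
  using arcs_nonempty by (auto simp: interceptor_profiles_def PiE_eq_empty_iff)

lemma agent_profile_path: "a \<in> agent_profiles G s t n \<Longrightarrow> i < n \<Longrightarrow> a i \<in> paths"
  by (auto simp: agent_profiles_def PiE_iff)

lemma set_pmf_correlated: "\<sigma> \<in> correlated G s t n \<Longrightarrow> set_pmf \<sigma> \<subseteq> agent_profiles G s t n"
  by (simp add: correlated_def distributions_on_def)

lemma Pi_pmf_uncorrelated:
  "(\<And>i. i < n \<Longrightarrow> set_pmf (\<sigma> i) \<subseteq> paths) \<Longrightarrow> Pi_pmf {..<n} undefined \<sigma> \<in> uncorrelated G s t n"
  by (auto simp: uncorrelated_def distributions_on_def)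

lemma uncorrelated_imp_correlated: "\<tau> \<in> uncorrelated G s t n \<Longrightarrow> \<tau> \<in> correlated G s t n"
  using uncorrelated_subset_correlated by (rule subsetD)

lemma integrable_correlated:
  "\<sigma> \<in> correlated G s t n \<Longrightarrow> integrable (measure_pmf \<sigma>) (f :: _ \<Rightarrow> real)"
  by (intro integrable_measure_pmf_finite finite_subset[OF _ finite_agent_profiles] set_pmf_correlated)

lemma card_agent_profile:
  assumes "a \<in> agent_profiles G s t n"
  shows "real (card (\<Union>i<n. a i)) = (\<Sum>e\<in>arcs G. indicator {a. e \<in> (\<Union>i<n. a i)} a)"
proof -
  have "(\<Union>i<n. a i) \<subseteq> arcs G"
    using agent_profile_path[OF assms] st_path_subset by blast
  then have "arcs G \<inter> {e. e \<in> (\<Union>i<n. a i)} = (\<Union>i<n. a i)"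
    by auto
  then have "real (card (\<Union>i<n. a i)) = (\<Sum>e\<in>arcs G. of_bool (e \<in> (\<Union>i<n. a i)))"
    by (simp del: UN_iff)
  also have "\<dots> = (\<Sum>e\<in>arcs G. indicator {a. e \<in> (\<Union>i<n. a i)} a)"
    by (intro sum.cong) (auto simp: indicator_def)
  finally show ?thesis .
qed

lemma sum_hit:
  assumes "\<sigma> \<in> correlated G s t n"
  shows "(\<Sum>e\<in>arcs G. hit n \<sigma> e) = measure_pmf.expectation \<sigma> (\<lambda>a. real (card (\<Union>i<n. a i)))"
proof -
  have "measure_pmf.expectation \<sigma> (\<lambda>a. real (card (\<Union>i<n. a i))) =
      measure_pmf.expectation \<sigma> (\<lambda>a. \<Sum>e\<in>arcs G. indicator {a. e \<in> (\<Union>i<n. a i)} a)"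
    using card_agent_profile set_pmf_correlated[OF assms]
    by (intro integral_cong_AE) (auto simp: AE_measure_pmf_iff simp del: UN_iff)
  then show ?thesis
    using integrable_correlated[OF assms] by (simp add: Bochner_Integration.integral_sum hit_def)
qed

text \<open>By linearity of expectation the cost sees a strategy only through the hit probabilities
  of single arcs.\<close>

lemma expectation_sum_cost:
  assumes "\<sigma> \<in> correlated G s t n"
  shows "measure_pmf.expectation \<sigma> (\<lambda>a. sum_cost n k \<alpha> a d) =
    (\<Sum>e\<in>arcs G. hit n \<sigma> e) + \<alpha> * (\<Sum>j<k. hit n \<sigma> (d j))"
proof -
  have "sum_cost n k \<alpha> a d = real (card (\<Union>i<n. a i)) +
      \<alpha> * (\<Sum>j<k. indicator {a. d j \<in> (\<Union>i<n. a i)} a)" for a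
    unfolding sum_cost_def by (simp add: indicator_def of_bool_def)
  then show ?thesis
    using integrable_correlated[OF assms]
    by (simp add: sum_hit[OF assms, symmetric] Bochner_Integration.integral_sum Bochner_Integration.integral_add
        hit_def del: UN_iff)
qed

text \<open>All \<open>k\<close> interceptors sit on \<open>e\<close>; the constant tuple is
  restricted because interceptor profiles are extensional.\<close>

lemma worst_cost_ge:
  assumes "\<sigma> \<in> correlated G s t n" "e \<in> arcs G"
  shows "(\<Sum>e\<in>arcs G. hit n \<sigma> e) + \<alpha> * real k * hit n \<sigma> e \<le> worst_cost G n k \<alpha> \<sigma>"
proof -
  let ?d = "restrict (\<lambda>_. e) {..<k}"
  have "?d \<in> interceptor_profiles G k"
    using assms(2) by (auto simp: interceptor_profiles_def)
  then have "measure_pmf.expectation \<sigma> (\<lambda>a. sum_cost n k \<alpha> a ?d) \<le> worst_cost G n k \<alpha> \<sigma>"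
    unfolding worst_cost_def by (intro Max_ge finite_imageI finite_interceptor_profiles) auto
  then show ?thesis
    by (simp add: expectation_sum_cost[OF assms(1)] mult.assoc)
qed

lemma worst_cost_le:
  assumes \<sigma>: "\<sigma> \<in> correlated G s t n" and "\<alpha> \<ge> 0"
    and M: "\<And>e. e \<in> arcs G \<Longrightarrow> hit n \<sigma> e \<le> M"
  shows "worst_cost G n k \<alpha> \<sigma> \<le> (\<Sum>e\<in>arcs G. hit n \<sigma> e) + \<alpha> * real k * M"
proof -
  have "(\<Sum>j<k. hit n \<sigma> (d j)) \<le> real k * M" if "d \<in> interceptor_profiles G k" for d
    using sum_bounded_above[of "{..<k}" "\<lambda>j. hit n \<sigma> (d j)" M] M that
    by (auto simp: interceptor_profiles_def PiE_iff)
  then show ?thesis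
    unfolding worst_cost_def
    using \<open>\<alpha> \<ge> 0\<close> finite_interceptor_profiles interceptor_profiles_nonempty
    by (subst Max_le_iff) (auto simp: expectation_sum_cost[OF \<sigma>] mult.assoc intro!: mult_left_mono)
qed

section \<open>Extreme path lengths and minimum cuts\<close>

lemma min_path_size_le: "p \<in> paths \<Longrightarrow> min_path_size G s t \<le> card p"
  unfolding min_path_size_def using finite_st_paths by (intro Min_le) auto

lemma max_path_size_ge: "p \<in> paths \<Longrightarrow> card p \<le> max_path_size G s t"
  unfolding max_path_size_def using finite_st_paths by (intro Max_ge) auto

lemma min_path_attained: obtains p where "p \<in> paths" "card p = min_path_size G s t"
proof -
  have "min_path_size G s t \<in> card ` paths"
    unfolding min_path_size_def using finite_st_paths st_paths_nonempty by (intro Min_in) auto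
  then show ?thesis
    using that by auto
qed

lemma min_path_size_pos: "min_path_size G s t > 0"
proof -
  obtain p where "p \<in> paths" "card p = min_path_size G s t"
    by (rule min_path_attained)
  then show ?thesis
    using st_path_nonempty[of p] finite_st_path[of p] by (metis card_gt_0_iff)
qed

lemma finite_cuts: "finite {S. st_cut G s t S}"
  by (rule finite_subset[of _ "Pow (arcs G)"]) (auto simp: st_cut_def)

lemma min_cut_size_le: "st_cut G s t S \<Longrightarrow> min_cut_size G s t \<le> card S"
  unfolding min_cut_size_def using finite_cuts by (intro Min_le) auto

lemma min_cut_attained: obtains S where "st_cut G s t S" "card S = min_cut_size G s t"
proof -
  \<comment> \<open>Since \<open>s \<noteq> t\<close>, every path is nonempty; so the set of all
    arcs is a cut and \<open>Min\<close> ranges over a nonempty set.\<close>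
  have "st_cut G s t (arcs G)"
    unfolding st_cut_def using st_path_subset st_path_nonempty by fast
  then have "min_cut_size G s t \<in> card ` {S. st_cut G s t S}"
    unfolding min_cut_size_def using finite_cuts by (intro Min_in) auto
  then show ?thesis
    using that by auto
qed

lemma min_cut_size_pos: "min_cut_size G s t > 0"
proof -
  obtain S where S: "st_cut G s t S" "card S = min_cut_size G s t"
    by (rule min_cut_attained)
  then have "S \<noteq> {}" "finite S"
    using st_paths_nonempty finite_subset[OF _ finite_arcs] by (auto simp: st_cut_def)
  with S show ?thesis
    by (metis card_gt_0_iff)
qed

section \<open>Existence of optimal strategies\<close>

text \<open>The worst cost is a maximum of finitely many functions linear in the probabilities,
  hence continuous; a joint distribution is a family indexed by \<open>unit\<close>.\<close>

lemma correlated_attains_min: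
  obtains \<sigma> where "\<sigma> \<in> correlated G s t n"
    "minimum_on (worst_cost G n k \<alpha>) (correlated G s t n) = worst_cost G n k \<alpha> \<sigma>"
    "\<And>\<tau>. \<tau> \<in> correlated G s t n \<Longrightarrow> worst_cost G n k \<alpha> \<sigma> \<le> worst_cost G n k \<alpha> \<tau>"
proof -
  define \<Phi> where "\<Phi> f = Max ((\<lambda>d. \<Sum>a\<in>agent_profiles G s t n. sum_cost n k \<alpha> a d * f ((), a))
      ` interceptor_profiles G k)" for f :: "unit \<times> (nat \<Rightarrow> 'e set) \<Rightarrow> real"
  have "continuous_on UNIV \<Phi>"
    unfolding \<Phi>_def
    by (intro continuous_on_Max finite_interceptor_profiles interceptor_profiles_nonempty
        continuous_intros) simp
  then obtain \<sigma> :: "unit \<Rightarrow> (nat \<Rightarrow> 'e set) pmf"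
    where \<sigma>: "\<And>i. set_pmf (\<sigma> i) \<subseteq> agent_profiles G s t n"
    and opt: "\<And>\<tau>. (\<And>i. set_pmf (\<tau> i) \<subseteq> agent_profiles G s t n) \<Longrightarrow>
       \<Phi> (\<lambda>(i, x). pmf (\<sigma> i) x) \<le> \<Phi> (\<lambda>(i, x). pmf (\<tau> i) x)"
    using pmf_family_attains_min[OF finite_agent_profiles agent_profiles_nonempty] by metis
  have cost: "worst_cost G n k \<alpha> \<tau> = \<Phi> (\<lambda>(i, x). pmf \<tau> x)" if "set_pmf \<tau> \<subseteq> agent_profiles G s t n" for \<tau>
    unfolding worst_cost_def \<Phi>_def
    using that by (subst integral_measure_pmf_real[OF finite_agent_profiles]) auto
  have le: "worst_cost G n k \<alpha> (\<sigma> ()) \<le> worst_cost G n k \<alpha> \<tau>" if "\<tau> \<in> correlated G s t n" for \<tau>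
    using opt[of "\<lambda>_. \<tau>"] \<sigma> cost set_pmf_correlated[OF that] by (simp add: case_prod_unfold)
  show ?thesis
  proof (rule that)
    show "\<sigma> () \<in> correlated G s t n"
      using \<sigma> by (simp add: correlated_def distributions_on_def)
    then show "minimum_on (worst_cost G n k \<alpha>) (correlated G s t n) = worst_cost G n k \<alpha> (\<sigma> ())"
      using le by (rule minimum_on_eq)
  qed (rule le)
qed

text \<open>For independent agents the expected cost is a polynomial in the individual
  probabilities, no longer linear but still continuous.\<close>

lemma uncorrelated_attains_min:
  obtains \<sigma> where "\<sigma> \<in> uncorrelated G s t n"
    "minimum_on (worst_cost G n k \<alpha>) (uncorrelated G s t n) = worst_cost G n k \<alpha> \<sigma>"
    "\<And>\<tau>. \<tau> \<in> uncorrelated G s t n \<Longrightarrow> worst_cost G n k \<alpha> \<sigma> \<le> worst_cost G n k \<alpha> \<tau>"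
proof -
  define \<Phi> where "\<Phi> f = Max ((\<lambda>d. \<Sum>a\<in>agent_profiles G s t n. sum_cost n k \<alpha> a d *
      (\<Prod>i<n. f (i, a i))) ` interceptor_profiles G k)" for f :: "nat \<times> 'e set \<Rightarrow> real"
  have "continuous_on UNIV \<Phi>"
    unfolding \<Phi>_def
    by (intro continuous_on_Max finite_interceptor_profiles interceptor_profiles_nonempty
        continuous_intros) simp
  then obtain \<sigma> :: "nat \<Rightarrow> 'e set pmf"
    where \<sigma>: "\<And>i. set_pmf (\<sigma> i) \<subseteq> paths"
    and opt: "\<And>\<tau>. (\<And>i. set_pmf (\<tau> i) \<subseteq> paths) \<Longrightarrow>
       \<Phi> (\<lambda>(i, x). pmf (\<sigma> i) x) \<le> \<Phi> (\<lambda>(i, x). pmf (\<tau> i) x)"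
    using pmf_family_attains_min[OF finite_st_paths st_paths_nonempty] by metis
  let ?P = "Pi_pmf {..<n} undefined"
  have cost: "worst_cost G n k \<alpha> (?P \<tau>) = \<Phi> (\<lambda>(i, x). pmf (\<tau> i) x)" if "\<And>i. set_pmf (\<tau> i) \<subseteq> paths" for \<tau>
  proof -
    have "set_pmf (?P \<tau>) \<subseteq> agent_profiles G s t n"
      by (intro set_pmf_correlated uncorrelated_imp_correlated Pi_pmf_uncorrelated that)
    moreover have "pmf (?P \<tau>) a = (\<Prod>i<n. pmf (\<tau> i) (a i))" if "a \<in> agent_profiles G s t n" for a
      using that by (subst pmf_Pi') (auto simp: agent_profiles_def PiE_iff extensional_def)
    ultimately show ?thesis
      unfolding worst_cost_def \<Phi>_def
      by (subst integral_measure_pmf_real[OF finite_agent_profiles]) auto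
  qed
  have le: "worst_cost G n k \<alpha> (?P \<sigma>) \<le> worst_cost G n k \<alpha> \<tau>" if \<tau>: "\<tau> \<in> uncorrelated G s t n" for \<tau>
  proof -
    obtain \<tau>' where \<tau>': "\<tau> = ?P \<tau>'" "\<And>i. i < n \<Longrightarrow> set_pmf (\<tau>' i) \<subseteq> paths"
      using \<tau> by (auto simp: uncorrelated_def distributions_on_def)
    \<comment> \<open>The compactness lemma constrains the whole family, while
      \<open>\<tau>'\<close> is only known below \<open>n\<close>. Padding with
      \<open>\<sigma>\<close> leaves the product over \<open>{..<n}\<close> unchanged.\<close>
    define \<tau>'' where "\<tau>'' i = (if i < n then \<tau>' i else \<sigma> i)" for i
    have "\<tau> = ?P \<tau>''"
      unfolding \<tau>'(1) by (intro Pi_pmf_cong) (auto simp: \<tau>''_def)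
    moreover have "set_pmf (\<tau>'' i) \<subseteq> paths" for i
      using \<sigma> \<tau>'(2) by (simp add: \<tau>''_def)
    ultimately show ?thesis
      using opt[of \<tau>''] cost \<sigma> by simp
  qed
  show ?thesis
  proof (rule that)
    show "?P \<sigma> \<in> uncorrelated G s t n"
      by (intro Pi_pmf_uncorrelated \<sigma>)
    then show "minimum_on (worst_cost G n k \<alpha>) (uncorrelated G s t n) = worst_cost G n k \<alpha> (?P \<sigma>)"
      using le by (rule minimum_on_eq)
  qed (rule le)
qed

subsection \<open>Fractional Menger theorem\<close>

text \<open>Discrete intermediate value argument: the first arc whose head lies above
  \<open>\<theta>\<close> still has its tail at or below it.\<close>

lemma awalk_crosses_level:
  fixes d :: "'v \<Rightarrow> real"
  assumes "awalk u p v" "d u \<le> \<theta>" "\<theta> < d v"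
  shows "\<exists>e\<in>set p. d (tail G e) \<le> \<theta> \<and> \<theta> < d (head G e)"
  using assms
proof (induction p arbitrary: u)
  case Nil
  then show ?case
    by (auto simp: awalk_Nil_iff)
next
  case (Cons e p)
  then show ?case
    by (cases "d (head G e) \<le> \<theta>") (auto simp: awalk_Cons_iff)
qed

text \<open>
  With \<open>d\<close> the \<open>w\<close>-distance from \<open>s\<close>, every level \<open>\<theta> \<in> {0..<L}\<close> yields the cut of the arcs crossing it,
  and each arc crosses a set of levels of measure at most \<open>w e\<close>; integrate over \<open>\<theta>\<close>.
\<close>

lemma min_cut_size_mult_length_le:
  fixes w :: "'e \<Rightarrow> real"
  assumes w: "\<And>e. e \<in> arcs G \<Longrightarrow> w e \<ge> 0"
    and L: "\<And>p. p \<in> paths \<Longrightarrow> L \<le> (\<Sum>e\<in>p. w e)"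
  shows "real (min_cut_size G s t) * L \<le> (\<Sum>e\<in>arcs G. w e)"
proof (cases "L \<ge> 0")
  case False
  then have "real (min_cut_size G s t) * L \<le> 0"
    by (simp add: mult_nonneg_nonpos)
  also have "0 \<le> (\<Sum>e\<in>arcs G. w e)"
    using w by (rule sum_nonneg)
  finally show ?thesis .
next
  case True
  \<comment> \<open>Summing over the set of arcs of a walk, not along the list, leaves finitely many
    values, so that \<open>Min\<close> is meaningful.\<close>
  define W where "W v = (\<lambda>p. \<Sum>e\<in>set p. w e) ` {p. awalk s p v}" for v
  define d where "d v = Min (W v)" for v
  have finW: "finite (W v)" for v
  proof (rule finite_subset)
    show "W v \<subseteq> (\<lambda>S. \<Sum>e\<in>S. w e) ` Pow (arcs G)"
      by (auto simp: W_def awalk_def)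
  qed auto
  have d_le: "d v \<le> (\<Sum>e\<in>set p. w e)" if "awalk s p v" for p v
    unfolding d_def using that by (intro Min_le finW) (auto simp: W_def)
  have d_attained: "\<exists>p. awalk s p v \<and> d v = (\<Sum>e\<in>set p. w e)" if "awalk s q v" for q v
  proof -
    have "d v \<in> W v"
      unfolding d_def using that by (intro Min_in finW) (auto simp: W_def)
    then show ?thesis
      by (auto simp: W_def)
  qed
  have ds: "d s \<le> 0"
    using d_le[of "[]" s] source by (simp add: awalk_Nil_iff)
  have dt: "L \<le> d t"
  proof -
    obtain e where "e \<in> arcs G"
      using arcs_nonempty by blast
    then obtain q where "awalk s q t"
      using arc_on_path by (auto simp: apath_def)
    then obtain p where p: "awalk s p t" "d t = (\<Sum>e\<in>set p. w e)"
      using d_attained by blast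
    \<comment> \<open>The bound \<open>L\<close> concerns paths only; shortcutting the walk drops
      arcs of nonnegative weight.\<close>
    have "L \<le> (\<Sum>e\<in>set (awalk_to_apath p). w e)"
      using apath_awalk_to_apath[OF p(1)] by (intro L) (auto simp: st_paths_def)
    also have "\<dots> \<le> (\<Sum>e\<in>set p. w e)"
      using awalk_to_apath_subset[OF p(1)] p(1) w by (intro sum_mono2) (auto simp: awalk_def)
    finally show ?thesis
      using p(2) by simp
  qed
  have d_head: "d (head G e) \<le> d (tail G e) + w e" if e: "e \<in> arcs G" for e
  proof -
    \<comment> \<open>A path through \<open>e\<close> shows that its tail is reachable from
      \<open>s\<close>, so that the distance of the tail is attained.\<close>
    obtain p where "apath s p t" "e \<in> set p"
      using arc_on_path[OF e] by blast
    then obtain q r where "awalk s (q @ e # r) t"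
      by (auto simp: apath_def in_set_conv_decomp)
    then have "awalk s q (tail G e)"
      by (auto simp: awalk_Cons_iff)
    then obtain q' where q': "awalk s q' (tail G e)" "d (tail G e) = (\<Sum>e\<in>set q'. w e)"
      using d_attained by blast
    have "awalk s (q' @ [e]) (head G e)"
      using q'(1) e by (intro awalk_appendI[OF _ arc_implies_awalk]) (auto simp: arc_to_ends_def)
    \<comment> \<open>The walk \<open>q'\<close> may already use \<open>e\<close>, hence
      \<open>insert\<close>; then \<open>w e \<ge> 0\<close> suffices.\<close>
    from d_le[OF this] have "d (head G e) \<le> (\<Sum>e\<in>insert e (set q'). w e)"
      by simp
    also have "\<dots> \<le> d (tail G e) + w e"
      using q'(2) w[OF e] by (simp add: sum.insert_if)
    finally show ?thesis .
  qed
  let ?I = "\<lambda>e. {d (tail G e)..<d (head G e)}"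
  have "st_cut G s t {e \<in> arcs G. \<theta> \<in> ?I e}" if "\<theta> \<in> {0..<L}" for \<theta>
    unfolding st_cut_def
  proof safe
    fix p assume "p \<in> paths" "p \<inter> {e \<in> arcs G. \<theta> \<in> ?I e} = {}"
    then obtain q where "awalk s q t" "p = set q"
      by (auto simp: st_paths_def apath_def)
    with awalk_crosses_level[of s q t d \<theta>] ds dt that st_path_subset[OF \<open>p \<in> paths\<close>]
      \<open>p \<inter> _ = {}\<close> show False
      by force
  qed
  then have "min_cut_size G s t \<le> card {e \<in> arcs G. \<theta> \<in> ?I e}" if "\<theta> \<in> {0..<L}" for \<theta>
    using that by (intro min_cut_size_le)
  moreover have "real (card {e \<in> arcs G. \<theta> \<in> ?I e}) = (\<Sum>e\<in>arcs G. indicator (?I e) \<theta>)" for \<theta> :: real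
    by (simp add: indicator_def[abs_def] of_bool_def[symmetric] Int_def)
  ultimately have le: "indicator {0..<L} \<theta> * real (min_cut_size G s t) \<le>
      (\<Sum>e\<in>arcs G. indicator (?I e) \<theta>)" for \<theta> :: real
    by (auto simp: indicator_def sum_nonneg)
  have intble: "integrable lborel (indicator {a..<b} :: real \<Rightarrow> real)" for a b :: real
    by (intro integrable_real_indicator emeasure_bounded_finite) auto
  have "(\<integral>\<theta>. indicator {0..<L} \<theta> * real (min_cut_size G s t) \<partial>lborel) \<le>
      (\<integral>\<theta>. (\<Sum>e\<in>arcs G. indicator (?I e) \<theta>) \<partial>lborel)"
    by (intro integral_mono le Bochner_Integration.integrable_sum integrable_mult_left intble)
  then have "real (min_cut_size G s t) * L \<le> (\<Sum>e\<in>arcs G. measure lborel (?I e))"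
    using True by (simp add: Bochner_Integration.integral_sum intble mult.commute)
  also have "\<dots> \<le> (\<Sum>e\<in>arcs G. w e)"
  proof (rule sum_mono)
    fix e assume "e \<in> arcs G"
    \<comment> \<open>If \<open>d\<close> drops along \<open>e\<close>, the interval is empty and
      \<open>w e \<ge> 0\<close> gives the bound.\<close>
    then show "measure lborel (?I e) \<le> w e"
      using d_head[of e] w[of e] by (cases "d (tail G e) \<le> d (head G e)") auto
  qed
  finally show ?thesis .
qed

lemma prob_path_eq_sum:
  assumes "set_pmf \<mu> \<subseteq> paths"
  shows "measure_pmf.prob \<mu> {p. e \<in> p} = (\<Sum>p\<in>paths. of_bool (e \<in> p) * pmf \<mu> p)"
proof -
  have "measure_pmf.prob \<mu> {p. e \<in> p} = measure_pmf.expectation \<mu> (indicator {p. e \<in> p})"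
    by simp
  also have "\<dots> = (\<Sum>p\<in>paths. indicator {p. e \<in> p} p * pmf \<mu> p)"
    using assms by (intro integral_measure_pmf_real finite_st_paths) auto
  also have "\<dots> = (\<Sum>p\<in>paths. of_bool (e \<in> p) * pmf \<mu> p)"
    by (intro sum.cong) (auto simp: indicator_def)
  finally show ?thesis .
qed

text \<open>At the minimiser the gradient is \<open>2 * w e\<close>. Moving mass towards any path
  \<open>p\<close> cannot decrease the objective, so the \<open>w\<close>-length of \<open>p\<close>
  is at least the sum of \<open>q e * w e\<close>. Taking this sum as \<open>L\<close> in the length
  inequality makes the sum of the squares of \<open>w e\<close> nonpositive, so every excess
  vanishes.\<close>

lemma path_pmf_le_inverse_min_cut_size:
  obtains \<mu> where "set_pmf \<mu> \<subseteq> paths"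
    "\<And>e. e \<in> arcs G \<Longrightarrow> measure_pmf.prob \<mu> {p. e \<in> p} \<le> 1 / real (min_cut_size G s t)"
proof -
  define m where "m = real (min_cut_size G s t)"
  have m: "m > 0"
    using min_cut_size_pos by (simp add: m_def)
  define \<Phi> where "\<Phi> f = (\<Sum>e\<in>arcs G. (max 0 ((\<Sum>p\<in>paths. of_bool (e \<in> p) * f ((), p)) - 1 / m))\<^sup>2)"
    for f :: "unit \<times> 'e set \<Rightarrow> real"
  have "continuous_on UNIV \<Phi>"
    unfolding \<Phi>_def by (intro continuous_intros) simp
  then obtain \<sigma> :: "unit \<Rightarrow> 'e set pmf"
    where \<sigma>: "\<And>i. set_pmf (\<sigma> i) \<subseteq> paths"
    and opt: "\<And>\<tau>. (\<And>i. set_pmf (\<tau> i) \<subseteq> paths) \<Longrightarrow>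
       \<Phi> (\<lambda>(i, x). pmf (\<sigma> i) x) \<le> \<Phi> (\<lambda>(i, x). pmf (\<tau> i) x)"
    using pmf_family_attains_min[OF finite_st_paths st_paths_nonempty] by metis
  define \<mu> where "\<mu> = \<sigma> ()"
  have \<mu>: "set_pmf \<mu> \<subseteq> paths"
    using \<sigma> by (simp add: \<mu>_def)
  define q where "q e = measure_pmf.prob \<mu> {p. e \<in> p}" for e
  define w where "w e = max 0 (q e - 1 / m)" for e
  have q01: "0 \<le> q e" "q e \<le> 1" for e
    by (auto simp: q_def)
  have \<Phi>_eq: "\<Phi> (\<lambda>(i, x). pmf \<nu> x) =
      (\<Sum>e\<in>arcs G. (max 0 (measure_pmf.prob \<nu> {p. e \<in> p} - 1 / m))\<^sup>2)"
    if "set_pmf \<nu> \<subseteq> paths" for \<nu>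
    by (simp add: \<Phi>_def prob_path_eq_sum[OF that])
  \<comment> \<open>First-order optimality of \<open>\<mu>\<close> in the direction of the point mass at \<open>p\<close>.\<close>
  have shift: "0 \<le> (\<Sum>e\<in>arcs G. (of_bool (e \<in> p) - q e) * w e)" if p: "p \<in> paths" for p
  proof (rule nonneg_if_quadratic_nonneg)
    fix x :: real assume x: "0 < x" "x < 1"
    \<comment> \<open>The mixture moves a fraction \<open>x\<close> of the mass to \<open>p\<close>;
      each \<open>q e\<close> then changes linearly in \<open>x\<close>.\<close>
    define \<nu> where "\<nu> = bernoulli_pmf x \<bind> (\<lambda>b. if b then return_pmf p else \<mu>)"
    have \<nu>: "set_pmf \<nu> \<subseteq> paths"
      using p \<mu> x by (auto simp: \<nu>_def split: if_splits)
    have "pmf \<nu> p' = x * of_bool (p' = p) + (1 - x) * pmf \<mu> p'" for p'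
      using x by (auto simp: \<nu>_def pmf_bind)
    then have "measure_pmf.prob \<nu> {p. e \<in> p} =
        (\<Sum>p'\<in>paths. x * (of_bool (e \<in> p') * of_bool (p' = p)) + (1 - x) * (of_bool (e \<in> p') * pmf \<mu> p'))" for e
      unfolding prob_path_eq_sum[OF \<nu>] by (intro sum.cong) (auto simp: algebra_simps)
    also have "\<dots> e = x * (\<Sum>p'\<in>paths. if p' = p then of_bool (e \<in> p) else 0) + (1 - x) * q e" for e
      unfolding q_def prob_path_eq_sum[OF \<mu>] sum.distrib sum_distrib_left
      by (intro arg_cong2[of _ _ _ _ "(+)"] sum.cong) auto
    finally have "measure_pmf.prob \<nu> {p. e \<in> p} - 1 / m =
        (q e - 1 / m) + x * (of_bool (e \<in> p) - q e)" for e
      using p finite_st_paths by (simp add: algebra_simps)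
    then have "\<Phi> (\<lambda>(i, x). pmf \<nu> x) =
        (\<Sum>e\<in>arcs G. (max 0 ((q e - 1 / m) + x * (of_bool (e \<in> p) - q e)))\<^sup>2)"
      by (simp only: \<Phi>_eq[OF \<nu>])
    also have "\<dots> \<le> (\<Sum>e\<in>arcs G. (w e)\<^sup>2 + 2 * (x * (of_bool (e \<in> p) - q e)) * w e + x\<^sup>2 * 1)"
    proof (rule sum_mono)
      fix e
      have "\<bar>of_bool (e \<in> p) - q e\<bar> \<le> 1"
        using q01[of e] by auto
      then have "(x * (of_bool (e \<in> p) - q e))\<^sup>2 \<le> x\<^sup>2 * 1"
        unfolding power_mult_distrib by (intro mult_left_mono) (auto simp: abs_square_le_1)
      then show "(max 0 ((q e - 1 / m) + x * (of_bool (e \<in> p) - q e)))\<^sup>2 \<le>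
          (w e)\<^sup>2 + 2 * (x * (of_bool (e \<in> p) - q e)) * w e + x\<^sup>2 * 1"
        using max_0_add_square_le[of "q e - 1 / m" "x * (of_bool (e \<in> p) - q e)"]
        unfolding w_def by linarith
    qed
    also have "\<dots> = (\<Sum>e\<in>arcs G. (w e)\<^sup>2) +
        2 * x * (\<Sum>e\<in>arcs G. (of_bool (e \<in> p) - q e) * w e) + x\<^sup>2 * real (card (arcs G))"
      by (simp add: sum.distrib sum_distrib_left mult.assoc)
    finally have "\<Phi> (\<lambda>(i, x). pmf \<nu> x) \<le> \<dots>" .
    moreover have "\<Phi> (\<lambda>(i, x). pmf \<mu> x) \<le> \<Phi> (\<lambda>(i, x). pmf \<nu> x)"
      using opt[of "\<lambda>_. \<nu>"] \<nu> by (simp add: \<mu>_def case_prod_unfold)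
    moreover have "\<Phi> (\<lambda>(i, x). pmf \<mu> x) = (\<Sum>e\<in>arcs G. (w e)\<^sup>2)"
      by (simp add: \<Phi>_eq[OF \<mu>] w_def q_def)
    ultimately show "0 \<le> 2 * x * (\<Sum>e\<in>arcs G. (of_bool (e \<in> p) - q e) * w e) + x\<^sup>2 * real (card (arcs G))"
      by linarith
  qed simp
  have "m * (\<Sum>e\<in>arcs G. q e * w e) \<le> (\<Sum>e\<in>arcs G. w e)"
    unfolding m_def
  proof (rule min_cut_size_mult_length_le)
    fix p assume p: "p \<in> paths"
    have "(\<Sum>e\<in>arcs G. of_bool (e \<in> p) * w e) = (\<Sum>e\<in>p. w e)"
      using st_path_subset[OF p] by (intro sum.mono_neutral_cong_right) auto
    then show "(\<Sum>e\<in>arcs G. q e * w e) \<le> (\<Sum>e\<in>p. w e)"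
      using shift[OF p] by (simp add: left_diff_distrib sum_subtractf)
  qed (simp add: w_def)
  \<comment> \<open>Wherever the positive part \<open>w e\<close> is nonzero it equals
    \<open>q e - 1 / m\<close>.\<close>
  moreover have "(w e)\<^sup>2 = q e * w e - w e / m" for e
    by (auto simp: w_def max_def power2_eq_square algebra_simps diff_divide_distrib)
  then have "(\<Sum>e\<in>arcs G. (w e)\<^sup>2) = (\<Sum>e\<in>arcs G. q e * w e) - (\<Sum>e\<in>arcs G. w e) / m"
    by (simp only: sum_subtractf sum_divide_distrib)
  ultimately have "(\<Sum>e\<in>arcs G. (w e)\<^sup>2) \<le> 0"
    using m by (simp add: le_divide_eq mult.commute)
  then have "(\<Sum>e\<in>arcs G. (w e)\<^sup>2) = 0"
    by (intro antisym sum_nonneg) auto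
  then have "w e = 0" if "e \<in> arcs G" for e
    using that by (simp add: sum_nonneg_eq_0_iff)
  then have "q e \<le> 1 / m" if "e \<in> arcs G" for e
    using that by (fastforce simp: w_def max_def split: if_splits)
  with \<mu> show ?thesis
    using that[of \<mu>] by (simp add: q_def m_def)
qed

text \<open>The random path meets the cut almost surely; apply the union bound.\<close>

lemma cut_prob_sum_ge_1:
  assumes S: "st_cut G s t S" and \<mu>: "set_pmf \<mu> \<subseteq> paths"
  shows "1 \<le> (\<Sum>e\<in>S. measure_pmf.prob \<mu> {p. e \<in> p})"
proof -
  have fin: "finite S"
    using S finite_subset[OF _ finite_arcs] by (auto simp: st_cut_def)
  have "1 = measure_pmf.prob \<mu> (\<Union>e\<in>S. {p. e \<in> p})"
    using S \<mu> by (intro sym[OF measure_pmf.prob_eq_1[THEN iffD2]])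
      (fastforce simp: AE_measure_pmf_iff st_cut_def)+
  also have "\<dots> \<le> (\<Sum>e\<in>S. measure_pmf.prob \<mu> {p. e \<in> p})"
    using fin by (intro measure_pmf.finite_measure_subadditive_finite) auto
  finally show ?thesis .
qed

subsection \<open>Optimal costs\<close>

lemma min_path_size_le_sum_hit:
  assumes \<sigma>: "\<sigma> \<in> correlated G s t n" and n: "n > 0"
  shows "real (min_path_size G s t) \<le> (\<Sum>e\<in>arcs G. hit n \<sigma> e)"
  unfolding sum_hit[OF \<sigma>]
proof (rule measure_pmf.integral_ge_const[OF integrable_correlated[OF \<sigma>]])
  have "min_path_size G s t \<le> card (\<Union>i<n. a i)" if a: "a \<in> agent_profiles G s t n" for a
  proof -
    have "min_path_size G s t \<le> card (a 0)"
      using n by (intro min_path_size_le agent_profile_path[OF a])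
    also have "\<dots> \<le> card (\<Union>i<n. a i)"
      using n agent_profile_path[OF a] finite_st_path by (intro card_mono) auto
    finally show ?thesis .
  qed
  then show "AE a in measure_pmf \<sigma>. real (min_path_size G s t) \<le> real (card (\<Union>i<n. a i))"
    using set_pmf_correlated[OF \<sigma>] by (auto simp: AE_measure_pmf_iff)
qed

lemma sum_hit_le_max_path_size:
  assumes \<sigma>: "\<sigma> \<in> correlated G s t n"
  shows "(\<Sum>e\<in>arcs G. hit n \<sigma> e) \<le> real n * real (max_path_size G s t)"
  unfolding sum_hit[OF \<sigma>]
proof (rule measure_pmf.integral_le_const[OF integrable_correlated[OF \<sigma>]])
  have "card (\<Union>i<n. a i) \<le> n * max_path_size G s t" if a: "a \<in> agent_profiles G s t n" for a
  proof -
    have "card (\<Union>i<n. a i) \<le> (\<Sum>i<n. card (a i))"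
      by (rule card_UN_le) simp
    also have "\<dots> \<le> (\<Sum>i<n. max_path_size G s t)"
      using agent_profile_path[OF a] by (intro sum_mono max_path_size_ge) auto
    finally show ?thesis
      by simp
  qed
  then show "AE a in measure_pmf \<sigma>. real (card (\<Union>i<n. a i)) \<le> real n * real (max_path_size G s t)"
    using set_pmf_correlated[OF \<sigma>] unfolding of_nat_mult[symmetric] of_nat_le_iff
    by (auto simp: AE_measure_pmf_iff)
qed

lemma worst_cost_ge_if_cut_hit:
  assumes \<sigma>: "\<sigma> \<in> correlated G s t n" and "n > 0" "\<alpha> \<ge> 0"
    and S: "st_cut G s t S" and e: "e \<in> S" "x \<le> hit n \<sigma> e"
  shows "real (min_path_size G s t) + \<alpha> * real k * x \<le> worst_cost G n k \<alpha> \<sigma>"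
proof -
  have "real (min_path_size G s t) + \<alpha> * real k * x \<le>
      (\<Sum>e\<in>arcs G. hit n \<sigma> e) + \<alpha> * real k * hit n \<sigma> e"
    using min_path_size_le_sum_hit[OF \<sigma> \<open>n > 0\<close>] e \<open>\<alpha> \<ge> 0\<close>
    by (intro add_mono mult_left_mono) auto
  also have "\<dots> \<le> worst_cost G n k \<alpha> \<sigma>"
    using S e by (intro worst_cost_ge \<sigma>) (auto simp: st_cut_def)
  finally show ?thesis .
qed

text \<open>Agent 0 alone must cross a minimum cut, so the hit probabilities there sum to at least 1
  and one of them is at least the average.\<close>

lemma correlated_cost_ge:
  assumes \<sigma>: "\<sigma> \<in> correlated G s t n" and n: "n > 0" and "\<alpha> \<ge> 0"
  shows "real (min_path_size G s t) + \<alpha> * real k * (1 / real (min_cut_size G s t)) \<le> worst_cost G n k \<alpha> \<sigma>"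
proof -
  obtain S where S: "st_cut G s t S" "card S = min_cut_size G s t"
    by (rule min_cut_attained)
  have S': "finite S" "S \<noteq> {}"
    using min_cut_size_pos S(2) by (auto intro: card_ge_0_finite)
  obtain e where "e \<in> S" "1 / real (card S) \<le> hit n \<sigma> e"
  proof (rule ccontr)
    assume "\<not> thesis"
    with that have "hit n \<sigma> e < 1 / real (card S)" if "e \<in> S" for e
      using \<open>e \<in> S\<close> by force
    then have "(\<Sum>e\<in>S. hit n \<sigma> e) < (\<Sum>e\<in>S. 1 / real (card S))"
      using S' by (intro sum_strict_mono) auto
    also have "\<dots> = 1"
      using S' by simp
    also have "\<dots> \<le> (\<Sum>e\<in>S. measure_pmf.prob (map_pmf (\<lambda>a. a 0) \<sigma>) {p. e \<in> p})"
      using set_pmf_correlated[OF \<sigma>] agent_profile_path n by (intro cut_prob_sum_ge_1 S) auto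
    also have "\<dots> \<le> (\<Sum>e\<in>S. hit n \<sigma> e)"
      using hit_ge[OF n, of \<sigma>] by (intro sum_mono) (simp add: vimage_def)
    finally show False
      by simp
  qed
  then show ?thesis
    using worst_cost_ge_if_cut_hit[OF \<sigma> n \<open>\<alpha> \<ge> 0\<close> S(1), of e] unfolding S(2) by blast
qed

text \<open>If every cut arc were hit too rarely, the product of all miss probabilities, over arcs
  and agents, would be too large: AM-GM along the cut bounds each agent's factor.\<close>

lemma uncorrelated_cost_ge:
  assumes \<tau>: "\<tau> \<in> uncorrelated G s t n" and n: "n > 0" and "\<alpha> \<ge> 0"
  defines "m \<equiv> min_cut_size G s t"
  shows "real (min_path_size G s t) + \<alpha> * real k * (\<E> m n / real m) \<le> worst_cost G n k \<alpha> \<tau>"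
proof -
  obtain S where S: "st_cut G s t S" "card S = m"
    unfolding m_def by (rule min_cut_attained)
  have m: "m > 0"
    using min_cut_size_pos by (simp add: m_def)
  then have S': "finite S" "S \<noteq> {}"
    using S(2) by (auto intro: card_ge_0_finite)
  obtain \<sigma> where \<sigma>: "\<tau> = Pi_pmf {..<n} undefined \<sigma>" "\<And>i. i < n \<Longrightarrow> set_pmf (\<sigma> i) \<subseteq> paths"
    using \<tau> by (auto simp: uncorrelated_def distributions_on_def)
  define q where "q i e = measure_pmf.prob (\<sigma> i) {p. e \<in> p}" for i e
  have q: "0 \<le> q i e" "q i e \<le> 1" for i e
    by (auto simp: q_def)
  let ?b = "1 - 1 / real m"
  obtain e where "e \<in> S" "\<E> m n / real m \<le> hit n \<tau> e"
  proof (rule ccontr)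
    assume "\<not> thesis"
    with that have "hit n \<tau> e < \<E> m n / real m" if "e \<in> S" for e
      using \<open>e \<in> S\<close> by force
    then have lt: "?b ^ n < (\<Prod>i<n. 1 - q i e)" if "e \<in> S" for e
      using that by (simp add: \<E>_div[OF m] \<sigma>(1) hit_Pi_pmf q_def)
    have "(\<Prod>e\<in>S. ?b ^ n) < (\<Prod>e\<in>S. \<Prod>i<n. 1 - q i e)"
    proof -
      have "0 \<le> ?b ^ n"
        using m by simp
      moreover obtain e where "e \<in> S"
        using S'(2) by blast
      ultimately show ?thesis
        using lt S'(1) by (intro prod_mono_strict[of e]) (auto intro: less_imp_le le_less_trans)
    qed
    \<comment> \<open>After the swap the inner product concerns one agent, whose miss probabilities
      sum to at most \<open>m - 1\<close> because that agent crosses the cut.\<close>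
    also have "\<dots> = (\<Prod>i<n. \<Prod>e\<in>S. 1 - q i e)"
      by (rule prod.swap)
    also have "\<dots> \<le> (\<Prod>i<n. ((real m - 1) / real (card S)) ^ card S)"
    proof (intro prod_mono conjI prod_le_mean_power prod_nonneg S' ballI)
      fix i assume "i \<in> {..<n}"
      then have "1 \<le> (\<Sum>e\<in>S. q i e)"
        unfolding q_def using \<sigma>(2) by (intro cut_prob_sum_ge_1 S) auto
      then show "(\<Sum>e\<in>S. 1 - q i e) \<le> real m - 1"
        by (simp add: sum_subtractf S(2))
    qed (use q in auto)
    also have "\<dots> = (\<Prod>e\<in>S. ?b ^ n)"
      using m by (simp add: S(2) diff_divide_distrib power_mult[symmetric] mult.commute)
    finally show False
      by simp
  qed
  then show ?thesis
    by (intro worst_cost_ge_if_cut_hit[OF uncorrelated_imp_correlated[OF \<tau>] n \<open>\<alpha> \<ge> 0\<close> S(1)])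
qed

text \<open>All agents follow one random path, so their union is a single path and the size term has
  no factor \<open>n\<close>.\<close>

lemma correlated_cost_le:
  assumes n: "n > 0" and "\<alpha> \<ge> 0"
  obtains \<sigma> where "\<sigma> \<in> correlated G s t n"
    "worst_cost G n k \<alpha> \<sigma> \<le> real (max_path_size G s t) + \<alpha> * real k * (1 / real (min_cut_size G s t))"
proof -
  obtain \<mu> where \<mu>: "set_pmf \<mu> \<subseteq> paths"
    "\<And>e. e \<in> arcs G \<Longrightarrow> measure_pmf.prob \<mu> {p. e \<in> p} \<le> 1 / real (min_cut_size G s t)"
    using path_pmf_le_inverse_min_cut_size by blast
  define \<sigma> where "\<sigma> = map_pmf (\<lambda>p. \<lambda>i\<in>{..<n}. p) \<mu>"
  have \<sigma>: "\<sigma> \<in> correlated G s t n"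
    using \<mu>(1) by (auto simp: \<sigma>_def correlated_def distributions_on_def agent_profiles_def)
  have union: "(\<Union>i<n. (\<lambda>i\<in>{..<n}. p) i) = p" for p :: "'e set"
    using n by auto
  have "hit n \<sigma> e \<le> 1 / real (min_cut_size G s t)" if "e \<in> arcs G" for e
    unfolding hit_def \<sigma>_def measure_map_pmf vimage_def mem_Collect_eq union using \<mu>(2)[OF that] .
  then have "worst_cost G n k \<alpha> \<sigma> \<le>
      (\<Sum>e\<in>arcs G. hit n \<sigma> e) + \<alpha> * real k * (1 / real (min_cut_size G s t))"
    by (intro worst_cost_le \<sigma> \<open>\<alpha> \<ge> 0\<close>)
  also have "(\<Sum>e\<in>arcs G. hit n \<sigma> e) \<le> real (max_path_size G s t)"
    unfolding sum_hit[OF \<sigma>]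
  proof (rule measure_pmf.integral_le_const[OF integrable_correlated[OF \<sigma>]])
    show "AE a in measure_pmf \<sigma>. real (card (\<Union>i<n. a i)) \<le> real (max_path_size G s t)"
      unfolding \<sigma>_def AE_measure_pmf_iff set_map_pmf ball_simps union
      using \<mu>(1) max_path_size_ge by auto
  qed
  finally show ?thesis
    using that[OF \<sigma>] by simp
qed

text \<open>The agents draw independently from the same \<open>\<mu>\<close>; the hit probability is
  then increasing in the probability that one agent uses the arc.\<close>

lemma uncorrelated_cost_le:
  assumes "\<alpha> \<ge> 0"
  defines "m \<equiv> min_cut_size G s t"
  obtains \<tau> where "\<tau> \<in> uncorrelated G s t n"
    "worst_cost G n k \<alpha> \<tau> \<le> real n * real (max_path_size G s t) + \<alpha> * real k * (\<E> m n / real m)"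
proof -
  obtain \<mu> where \<mu>: "set_pmf \<mu> \<subseteq> paths"
    "\<And>e. e \<in> arcs G \<Longrightarrow> measure_pmf.prob \<mu> {p. e \<in> p} \<le> 1 / real m"
    using path_pmf_le_inverse_min_cut_size unfolding m_def by blast
  define \<tau> where "\<tau> = Pi_pmf {..<n} undefined (\<lambda>_. \<mu>)"
  have m: "m > 0"
    using min_cut_size_pos by (simp add: m_def)
  have \<tau>: "\<tau> \<in> uncorrelated G s t n"
    unfolding \<tau>_def by (intro Pi_pmf_uncorrelated \<mu>)
  note \<tau>' = uncorrelated_imp_correlated[OF \<tau>]
  have "hit n \<tau> e \<le> \<E> m n / real m" if "e \<in> arcs G" for e
    unfolding \<tau>_def hit_Pi_pmf \<E>_div[OF m] prod_constant card_lessThan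
    using \<mu>(2)[OF that] m by (intro diff_left_mono power_mono) auto
  then have "worst_cost G n k \<alpha> \<tau> \<le> (\<Sum>e\<in>arcs G. hit n \<tau> e) + \<alpha> * real k * (\<E> m n / real m)"
    by (intro worst_cost_le \<tau>' \<open>\<alpha> \<ge> 0\<close>)
  with sum_hit_le_max_path_size[OF \<tau>'] show ?thesis
    using that[OF \<tau>] by simp
qed

text \<open>Making the agents independent keeps the marginals. By the union bound each hit
  probability, and with it both terms of the cost, grows by a factor of at most
  \<open>n\<close>.\<close>

lemma uncorrelated_cost_le_agents:
  assumes \<sigma>: "\<sigma> \<in> correlated G s t n" and "\<alpha> \<ge> 0"
  obtains \<tau> where "\<tau> \<in> uncorrelated G s t n" "worst_cost G n k \<alpha> \<tau> \<le> real n * worst_cost G n k \<alpha> \<sigma>"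
proof -
  define \<tau> where "\<tau> = Pi_pmf {..<n} undefined (\<lambda>i. map_pmf (\<lambda>a. a i) \<sigma>)"
  have marginal: "set_pmf (map_pmf (\<lambda>a. a i) \<sigma>) \<subseteq> paths" if "i < n" for i
    using set_pmf_correlated[OF \<sigma>] agent_profile_path[OF _ that] by auto
  then have \<tau>: "\<tau> \<in> uncorrelated G s t n"
    unfolding \<tau>_def by (intro Pi_pmf_uncorrelated)
  note \<tau>' = uncorrelated_imp_correlated[OF \<tau>]
  have hit_le: "hit n \<tau> e \<le> real n * hit n \<sigma> e" for e
  proof -
    have "hit n \<tau> e \<le> (\<Sum>i<n. measure_pmf.prob \<tau> {a. e \<in> a i})"
      by (rule hit_le_sum)
    also have "\<dots> = (\<Sum>i<n. measure_pmf.prob \<sigma> {a. e \<in> a i})"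
    proof (rule sum.cong)
      fix i assume "i \<in> {..<n}"
      then have "map_pmf (\<lambda>a. a i) \<tau> = map_pmf (\<lambda>a. a i) \<sigma>"
        unfolding \<tau>_def by (subst Pi_pmf_component) auto
      then have "measure_pmf.prob (map_pmf (\<lambda>a. a i) \<tau>) {p. e \<in> p} =
          measure_pmf.prob (map_pmf (\<lambda>a. a i) \<sigma>) {p. e \<in> p}"
        by simp
      then show "measure_pmf.prob \<tau> {a. e \<in> a i} = measure_pmf.prob \<sigma> {a. e \<in> a i}"
        by (simp add: vimage_def)
    qed simp
    also have "\<dots> \<le> (\<Sum>i<n. hit n \<sigma> e)"
      by (intro sum_mono hit_ge) simp
    finally show ?thesis
      by simp
  qed
  define M where "M = Max (hit n \<sigma> ` arcs G)"
  have "M \<in> hit n \<sigma> ` arcs G"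
    unfolding M_def using arcs_nonempty by (intro Max_in) auto
  then obtain e where e: "e \<in> arcs G" "M = hit n \<sigma> e"
    by blast
  have "worst_cost G n k \<alpha> \<tau> \<le> (\<Sum>e\<in>arcs G. hit n \<tau> e) + \<alpha> * real k * (real n * M)"
  proof (rule worst_cost_le[OF \<tau>' \<open>\<alpha> \<ge> 0\<close>])
    fix e assume "e \<in> arcs G"
    then have "hit n \<sigma> e \<le> M"
      unfolding M_def by (intro Max_ge) auto
    with hit_le[of e] show "hit n \<tau> e \<le> real n * M"
      by (meson mult_left_mono of_nat_0_le_iff order_trans)
  qed
  also have "(\<Sum>e\<in>arcs G. hit n \<tau> e) \<le> real n * (\<Sum>e\<in>arcs G. hit n \<sigma> e)"
    unfolding sum_distrib_left by (intro sum_mono hit_le)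
  also have "real n * (\<Sum>e\<in>arcs G. hit n \<sigma> e) + \<alpha> * real k * (real n * M) =
      real n * ((\<Sum>e\<in>arcs G. hit n \<sigma> e) + \<alpha> * real k * hit n \<sigma> e)"
    by (simp add: e(2) algebra_simps)
  also have "\<dots> \<le> real n * worst_cost G n k \<alpha> \<sigma>"
    by (intro mult_left_mono worst_cost_ge \<sigma> e) simp
  finally show ?thesis
    using that[OF \<tau>] by simp
qed

lemma uncorrelated_cost_le_shortest:
  assumes n: "n > 0" and "\<alpha> \<ge> 0"
  obtains \<tau> where "\<tau> \<in> uncorrelated G s t n"
    "worst_cost G n k \<alpha> \<tau> \<le> real (min_path_size G s t) + \<alpha> * real k"
proof -
  obtain p where p: "p \<in> paths" "card p = min_path_size G s t"
    by (rule min_path_attained)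
  define \<tau> where "\<tau> = Pi_pmf {..<n} undefined (\<lambda>_. return_pmf p)"
  have "set_pmf (return_pmf p) \<subseteq> paths"
    using p by simp
  then have \<tau>: "\<tau> \<in> uncorrelated G s t n"
    unfolding \<tau>_def by (intro Pi_pmf_uncorrelated)
  note \<tau>' = uncorrelated_imp_correlated[OF \<tau>]
  have "(\<Union>i<n. if i < n then p else undefined) = p"
    using n by auto
  then have "(\<Sum>e\<in>arcs G. hit n \<tau> e) = real (min_path_size G s t)"
    unfolding sum_hit[OF \<tau>'] by (simp add: \<tau>_def p(2))
  then show ?thesis
    using that[OF \<tau>] worst_cost_le[OF \<tau>' \<open>\<alpha> \<ge> 0\<close> hit_le_1] by simp
qed

section \<open>Bounds on the price of uncorrelation\<close>

text \<open>Explicit strategies bound each optimum from above and cut arguments from below; the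
  quotients of opposite bounds enclose \<open>r\<close>.\<close>

lemma price_of_uncorrelation_bounds:
  fixes n k :: nat and \<alpha> :: real
  assumes n: "n > 0" and \<alpha>: "\<alpha> \<ge> 0"
  defines "m \<equiv> min_cut_size G s t"
    and "pmax \<equiv> real (max_path_size G s t)"
    and "pmin \<equiv> real (min_path_size G s t)"
    and "r \<equiv> price_of_uncorrelation G s t n k \<alpha>"
  shows "r \<le> real n" "r \<le> real m" "r \<ge> 0"
    "r \<le> (real n * pmax + \<alpha> * real k * (\<E> m n / real m)) / (pmin + \<alpha> * real k * (1 / real m))"
    "(pmin + \<alpha> * real k * (\<E> m n / real m)) / (pmax + \<alpha> * real k * (1 / real m)) \<le> r"
proof -
  obtain \<sigma> where \<sigma>: "\<sigma> \<in> correlated G s t n"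
    "minimum_on (worst_cost G n k \<alpha>) (correlated G s t n) = worst_cost G n k \<alpha> \<sigma>"
    and \<sigma>_le: "\<And>\<sigma>'. \<sigma>' \<in> correlated G s t n \<Longrightarrow> worst_cost G n k \<alpha> \<sigma> \<le> worst_cost G n k \<alpha> \<sigma>'"
    using correlated_attains_min by blast
  obtain \<tau> where \<tau>: "\<tau> \<in> uncorrelated G s t n"
    "minimum_on (worst_cost G n k \<alpha>) (uncorrelated G s t n) = worst_cost G n k \<alpha> \<tau>"
    and \<tau>_le: "\<And>\<tau>'. \<tau>' \<in> uncorrelated G s t n \<Longrightarrow> worst_cost G n k \<alpha> \<tau> \<le> worst_cost G n k \<alpha> \<tau>'"
    using uncorrelated_attains_min by blast
  define C where "C = worst_cost G n k \<alpha> \<sigma>"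
  define U where "U = worst_cost G n k \<alpha> \<tau>"
  have r: "r = U / C"
    by (simp add: r_def price_of_uncorrelation_def \<sigma> \<tau> C_def U_def)
  have m: "m > 0"
    using min_cut_size_pos by (simp add: m_def)
  have pmin: "pmin > 0"
    using min_path_size_pos by (simp add: pmin_def)
  have C_ge: "pmin + \<alpha> * real k * (1 / real m) \<le> C"
    unfolding C_def pmin_def m_def by (rule correlated_cost_ge[OF \<sigma>(1) n \<alpha>])
  have low: "pmin + \<alpha> * real k * (1 / real m) > 0"
    using pmin \<alpha> by (simp add: add_pos_nonneg)
  then have C: "C > 0"
    using C_ge by linarith
  have C_le: "C \<le> pmax + \<alpha> * real k * (1 / real m)"
  proof -
    obtain \<sigma>' where "\<sigma>' \<in> correlated G s t n"
      "worst_cost G n k \<alpha> \<sigma>' \<le> pmax + \<alpha> * real k * (1 / real m)"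
      unfolding pmax_def m_def by (rule correlated_cost_le[OF n \<alpha>])
    then show ?thesis
      unfolding C_def using \<sigma>_le order_trans by blast
  qed
  have U_ge: "pmin + \<alpha> * real k * (\<E> m n / real m) \<le> U"
    unfolding U_def pmin_def m_def by (rule uncorrelated_cost_ge[OF \<tau>(1) n \<alpha>])
  have U_le: "U \<le> real n * pmax + \<alpha> * real k * (\<E> m n / real m)"
  proof -
    obtain \<tau>' where "\<tau>' \<in> uncorrelated G s t n"
      "worst_cost G n k \<alpha> \<tau>' \<le> real n * pmax + \<alpha> * real k * (\<E> m n / real m)"
      unfolding pmax_def m_def by (rule uncorrelated_cost_le[OF \<alpha>])
    then show ?thesis
      unfolding U_def using \<tau>_le order_trans by blast
  qed
  have num: "pmin + \<alpha> * real k * (\<E> m n / real m) \<ge> 0"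
    using pmin \<alpha> \<E>_pos[OF m n] by simp
  then have U: "U \<ge> 0"
    using U_ge by linarith
  show "r \<le> real n"
  proof -
    obtain \<tau>' where "\<tau>' \<in> uncorrelated G s t n" "worst_cost G n k \<alpha> \<tau>' \<le> real n * C"
      unfolding C_def by (rule uncorrelated_cost_le_agents[OF \<sigma>(1) \<alpha>])
    then have "U \<le> real n * C"
      unfolding U_def using \<tau>_le order_trans by blast
    then show ?thesis
      using C by (simp add: r divide_le_eq)
  qed
  show "r \<le> real m"
  proof -
    obtain \<tau>' where "\<tau>' \<in> uncorrelated G s t n" "worst_cost G n k \<alpha> \<tau>' \<le> pmin + \<alpha> * real k"
      unfolding pmin_def by (rule uncorrelated_cost_le_shortest[OF n \<alpha>])
    then have "U \<le> pmin + \<alpha> * real k"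
      unfolding U_def using \<tau>_le order_trans by blast
    \<comment> \<open>The interceptor terms agree, and \<open>pmin \<le> real m * pmin\<close> since
      \<open>m \<ge> 1\<close>.\<close>
    also have "\<dots> \<le> real m * (pmin + \<alpha> * real k * (1 / real m))"
      using m pmin by (simp add: distrib_left)
    also have "\<dots> \<le> real m * C"
      by (intro mult_left_mono C_ge) simp
    finally show ?thesis
      using C by (simp add: r divide_le_eq)
  qed
  show "r \<ge> 0"
    using C U by (simp add: r)
  show "r \<le> (real n * pmax + \<alpha> * real k * (\<E> m n / real m)) / (pmin + \<alpha> * real k * (1 / real m))"
    unfolding r using U_le C_ge U low C by (intro frac_le) auto
  show "(pmin + \<alpha> * real k * (\<E> m n / real m)) / (pmax + \<alpha> * real k * (1 / real m)) \<le> r"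
    unfolding r using U_ge C_le U C num by (intro frac_le) auto
qed

end

theorem theorem7:
  fixes G :: "('v, 'e) pre_digraph" and s t :: 'v
    and n k :: nat and \<alpha> \<epsilon> :: real
  assumes "st_graph G s t"
    and "n \<ge> 1" and "k \<ge> 1" and "\<alpha> > 0" and "\<epsilon> > 0"
  defines "m \<equiv> min_cut_size G s t"
    and "pmax \<equiv> real (max_path_size G s t)"
    and "pmin \<equiv> real (min_path_size G s t)"
    and "r \<equiv> price_of_uncorrelation G s t n k"
  shows "r \<alpha> \<le> real (min m n)
    \<and> (\<alpha> \<ge> real m / (real k * \<E> m n * \<epsilon>) * (real n * pmax - (1 + \<epsilon>) * \<E> m n * pmin)
         \<longrightarrow> r \<alpha> \<le> (1 + \<epsilon>) * \<E> m n)
    \<and> (\<alpha> \<ge> real m / (real k * \<E> m n * \<epsilon>) * ((1 - \<epsilon>) * \<E> m n * real n * pmax - pmin)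
         \<longrightarrow> r \<alpha> \<ge> (1 - \<epsilon>) * \<E> m n)
    \<and> (r \<longlongrightarrow> \<E> m n) at_top"
proof -
  interpret st_graph G s t
    by (fact assms(1))
  have n: "n > 0" and k: "real k > 0" and \<alpha>: "\<alpha> \<ge> 0"
    using assms by auto
  have m: "m > 0"
    unfolding m_def by (rule min_cut_size_pos)
  note E = \<E>_pos[OF m n]
  have pmin: "pmin > 0"
    unfolding pmin_def using min_path_size_pos by simp
  have pmax: "pmax > 0"
  proof -
    obtain p where "p \<in> paths"
      using st_paths_nonempty by blast
    then have "min_path_size G s t \<le> max_path_size G s t"
      using min_path_size_le max_path_size_ge order_trans by blast
    then show ?thesis
      using pmin by (simp add: pmin_def pmax_def)
  qed
  define c where "c = real k / real m"
  have c: "c > 0"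
    using k m by (simp add: c_def)
  have upper: "r x \<le> (real n * pmax + x * c * \<E> m n) / (pmin + x * c)"
    and lower: "(pmin + x * c * \<E> m n) / (pmax + x * c) \<le> r x" if "x \<ge> 0" for x
    using price_of_uncorrelation_bounds(4,5)[OF n that, of k]
    unfolding r_def m_def pmax_def pmin_def c_def by simp_all
  \<comment> \<open>Both hypotheses on \<open>\<alpha>\<close> have this shape. The right side is
    the slack that the factor \<open>1 + \<epsilon>\<close> or \<open>1 - \<epsilon>\<close> creates
    in the interception term.\<close>
  have threshold: "X \<le> \<alpha> * c * \<E> m n * \<epsilon>"
    if "\<alpha> \<ge> real m / (real k * \<E> m n * \<epsilon>) * X" for X
    using that k m E \<open>\<epsilon> > 0\<close> by (simp add: c_def field_simps)
  have pos: "pmin + \<alpha> * c > 0" "pmax + \<alpha> * c > 0"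
    using pmin pmax \<alpha> c by (simp_all add: add_pos_nonneg)
  have part1: "r \<alpha> \<le> real (min m n)"
    unfolding r_def m_def using price_of_uncorrelation_bounds(1,2)[OF n \<alpha>] by (simp add: min_def)
  have part2: "r \<alpha> \<le> (1 + \<epsilon>) * \<E> m n"
    if "\<alpha> \<ge> real m / (real k * \<E> m n * \<epsilon>) * (real n * pmax - (1 + \<epsilon>) * \<E> m n * pmin)"
  proof -
    have "real n * pmax + \<alpha> * c * \<E> m n \<le> (1 + \<epsilon>) * \<E> m n * (pmin + \<alpha> * c)"
      using threshold[OF that] by (simp add: algebra_simps)
    then have "(real n * pmax + \<alpha> * c * \<E> m n) / (pmin + \<alpha> * c) \<le> (1 + \<epsilon>) * \<E> m n"
      using pos by (simp add: divide_le_eq)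
    with upper[OF \<alpha>] show ?thesis
      by linarith
  qed
  have part3: "r \<alpha> \<ge> (1 - \<epsilon>) * \<E> m n"
    if "\<alpha> \<ge> real m / (real k * \<E> m n * \<epsilon>) * ((1 - \<epsilon>) * \<E> m n * real n * pmax - pmin)"
  \<comment> \<open>For \<open>\<epsilon> > 1\<close> the claimed bound is nonpositive and
    \<open>r \<alpha> \<ge> 0\<close> settles it.\<close>
  proof (cases "\<epsilon> \<le> 1")
    case True
    \<comment> \<open>The hypothesis on \<open>\<alpha>\<close> carries \<open>n * pmax\<close>, the
      lower bound on the price only \<open>pmax\<close>; replacing one by the other requires
      \<open>1 - \<epsilon> \<ge> 0\<close>.\<close>
    have "(1 - \<epsilon>) * \<E> m n * pmax * 1 \<le> (1 - \<epsilon>) * \<E> m n * pmax * real n"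
      using True E pmax n by (intro mult_left_mono) auto
    then have "(1 - \<epsilon>) * \<E> m n * (pmax + \<alpha> * c) \<le> pmin + \<alpha> * c * \<E> m n"
      using threshold[OF that] by (simp add: algebra_simps)
    then have "(1 - \<epsilon>) * \<E> m n \<le> (pmin + \<alpha> * c * \<E> m n) / (pmax + \<alpha> * c)"
      using pos by (simp add: le_divide_eq)
    with lower[OF \<alpha>] show ?thesis
      by linarith
  next
    case False
    then have "(1 - \<epsilon>) * \<E> m n \<le> 0"
      using E by (simp add: mult_nonpos_nonneg)
    also have "0 \<le> r \<alpha>"
      unfolding r_def by (rule price_of_uncorrelation_bounds(3)[OF n \<alpha>])
    finally show ?thesis .
  qed
  have part4: "(r \<longlongrightarrow> \<E> m n) at_top"
  proof (rule tendsto_sandwich)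
    show "\<forall>\<^sub>F x in at_top. (pmin + x * c * \<E> m n) / (pmax + x * c) \<le> r x"
      using eventually_ge_at_top[of 0] by eventually_elim (rule lower)
    show "\<forall>\<^sub>F x in at_top. r x \<le> (real n * pmax + x * c * \<E> m n) / (pmin + x * c)"
      using eventually_ge_at_top[of 0] by eventually_elim (rule upper)
  qed (intro tendsto_affine_ratio c)+
  from part1 part2 part3 part4 show ?thesis
    by blast
qed

end
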